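(* Let $P(\lambda)=A_2\lambda^2+A_1\lambda+A_0$ be a quaternion matrix polynomial, with $A_0,A_1,A_2\in M_n(\mathbb{H})$, and let $\Omega\subseteq\mathbb{H}$ be nonempty. Then $P(\lambda)$ is hyperstable with respect to $\Omega$ if any one of the following holds: (i) the multivariate polynomial $P(\lambda_1,\lambda_2)=A_2\lambda_1^2+A_1\lambda_2+A_0$ is stable with respect to $\Omega^2$; (ii) the multivariate polynomial $P(\lambda_1,\lambda_2)=A_2\lambda_1\lambda_2+A_1\lambda_2+A_0$ is stable with respect to $\Omega^2$ and $0\notin\Omega$.
   Context: $\mathbb{H}$ denotes the real quaternions, $M_n(\mathbb{H})$ the set of $n\times n$ quaternion matrices, $\mathbb{H}^n$ the space of quaternion column vectors, and $z^*$ the conjugate transpose. The polynomial $P(\lambda)=\sum_{i=0}^{2}A_i\lambda^i$ is hyperstable with respect to $\Omega$ if for every nonzero $y\in\mathbb{H}^n$ there is a nonzero $z\in\mathbb{H}^n$ with $\sum_{i=0}^2 z^*A_i y\mu^i\neq0$ for all $\mu\in\Omega$. A multivariate right quaternion matrix polynomial in $k$ variables has the form $P(\lambda_1,\dots,\lambda_k)=\sum_{w\in W}A_w\,w(\lambda_1,\dots,\lambda_k)$, where $A_w\in M_n(\mathbb{H})$ and $W$ is the set of all words, of length at most some fixed $m$, in the noncommuting letters $\lambda_1,\dots,\lambda_k$. It is stable with respect to $\Omega^k$ if for every nonzero $y\in\mathbb{H}^n$ and every $(\mu_1,\dots,\mu_k)\in\Omega^k$ there is a nonzero $z\in\mathbb{H}^n$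 with $\sum_{w\in W}z^*A_w y\,w(\mu_1,\dots,\mu_k)\neq0$. *)

theory Defs
  imports "HOL-Analysis.Finite_Cartesian_Product" "HOL-Library.Poly_Mapping"
    "HOL-Computational_Algebra.Polynomial"
begin

section \<open>Real quaternions\<close>

datatype quat = Quat (qRe: real) (qIm1: real) (qIm2: real) (qIm3: real)

lemma quat_eq_iff:
  "x = y \<longleftrightarrow> qRe x = qRe y \<and> qIm1 x = qIm1 y \<and> qIm2 x = qIm2 y \<and> qIm3 x = qIm3 y"
  by (auto simp: quat.expand)

instantiation quat :: ring_1
begin

definition zero_quat :: quat where "0 = Quat 0 0 0 0"

definition one_quat :: quat where "1 = Quat 1 0 0 0"

definition plus_quat :: "quat \<Rightarrow> quat \<Rightarrow> quat" where
  "x + y = Quat (qRe x + qRe y) (qIm1 x + qIm1 y) (qIm2 x + qIm2 y) (qIm3 x + qIm3 y)"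

definition uminus_quat :: "quat \<Rightarrow> quat" where
  "- x = Quat (- qRe x) (- qIm1 x) (- qIm2 x) (- qIm3 x)"

definition minus_quat :: "quat \<Rightarrow> quat \<Rightarrow> quat" where
  "x - y = Quat (qRe x - qRe y) (qIm1 x - qIm1 y) (qIm2 x - qIm2 y) (qIm3 x - qIm3 y)"

definition times_quat :: "quat \<Rightarrow> quat \<Rightarrow> quat" where
  "x * y = Quat
    (qRe x * qRe y - qIm1 x * qIm1 y - qIm2 x * qIm2 y - qIm3 x * qIm3 y)
    (qRe x * qIm1 y + qIm1 x * qRe y + qIm2 x * qIm3 y - qIm3 x * qIm2 y)
    (qRe x * qIm2 y - qIm1 x * qIm3 y + qIm2 x * qRe y + qIm3 x * qIm1 y)
    (qRe x * qIm3 y + qIm1 x * qIm2 y - qIm2 x * qIm1 y + qIm3 x * qRe y)"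

instance
  by standard
    (simp_all add: quat_eq_iff zero_quat_def one_quat_def plus_quat_def uminus_quat_def
      minus_quat_def times_quat_def,
      simp_all add: algebra_simps)

end

definition qcnj :: "quat \<Rightarrow> quat" where
  "qcnj x = Quat (qRe x) (- qIm1 x) (- qIm2 x) (- qIm3 x)"

instantiation quat :: division_ring
begin

definition inverse_quat :: "quat \<Rightarrow> quat" where
  "inverse x =
    (let r = (qRe x)\<^sup>2 + (qIm1 x)\<^sup>2 + (qIm2 x)\<^sup>2 + (qIm3 x)\<^sup>2
     in Quat (qRe x / r) (- qIm1 x / r) (- qIm2 x / r) (- qIm3 x / r))"

definition divide_quat :: "quat \<Rightarrow> quat \<Rightarrow> quat" where
  "x div y = x * inverse (y :: quat)"

instance
proof
  fix x y :: quat
  show "inverse 0 = (0 :: quat)"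
    by (simp add: inverse_quat_def zero_quat_def)
  show "x div y = x * inverse y"
    by (simp add: divide_quat_def)
  assume "x \<noteq> 0"
  define r where "r = (qRe x)\<^sup>2 + (qIm1 x)\<^sup>2 + (qIm2 x)\<^sup>2 + (qIm3 x)\<^sup>2"
  have r: "r = qRe x * qRe x + qIm1 x * qIm1 x + qIm2 x * qIm2 x + qIm3 x * qIm3 x"
    by (simp add: r_def power2_eq_square)
  have "r \<noteq> 0"
    using \<open>x \<noteq> 0\<close> unfolding r_def quat_eq_iff zero_quat_def
    by (simp add: add_nonneg_eq_0_iff)
  moreover have "inverse x = Quat (qRe x / r) (- qIm1 x / r) (- qIm2 x / r) (- qIm3 x / r)"
    by (simp add: inverse_quat_def Let_def r_def)
  ultimately show "inverse x * x = 1" "x * inverse x = 1"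
    by (simp_all add: times_quat_def one_quat_def divide_simps)
      (simp_all add: r algebra_simps)
qed

end

lemma quat_units:
  defines "i \<equiv> Quat 0 1 0 0" and "j \<equiv> Quat 0 0 1 0" and "k \<equiv> Quat 0 0 0 1"
  shows "i * i = - 1" "j * j = - 1" "k * k = - 1" "i * j = k" "j * k = i" "k * i = j"
  by (simp_all add: i_def j_def k_def times_quat_def uminus_quat_def one_quat_def)


section \<open>Quaternion matrix polynomials\<close>

text \<open>The quaternion \<open>z\<^sup>* A y\<close>.\<close>

definition sesq :: "quat ^ 'n \<Rightarrow> quat ^ 'n ^ 'n \<Rightarrow> quat ^ 'n \<Rightarrow> quat" where
  "sesq z A y = (\<Sum>i\<in>UNIV. qcnj (z $ i) * (A *v y) $ i)"

text \<open>A polynomial in one variable is given by its coefficient sequence, together with a formal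
  degree bound \<open>d\<close> (the coefficient of index \<open>d\<close> may vanish). The evaluation \<open>poly\<close> is not used:
  the powers of the variable stand to the right of \<open>z\<^sup>* A y\<close>.\<close>

definition hyperstable :: "nat \<Rightarrow> (quat ^ 'n ^ 'n) poly \<Rightarrow> quat set \<Rightarrow> bool" where
  "hyperstable d P \<Omega> \<longleftrightarrow>
    (\<forall>y. y \<noteq> 0 \<longrightarrow> (\<exists>z. z \<noteq> 0 \<and> (\<forall>\<mu>\<in>\<Omega>. (\<Sum>i\<le>d. sesq z (coeff P i) y * \<mu> ^ i) \<noteq> 0)))"

text \<open>Words in the letters \<open>\<lambda>\<^sub>1, \<dots>, \<lambda>\<^sub>k\<close> are lists of indices in \<open>{1..k}\<close>; a multivariate
  polynomial is a finitely supported family of coefficients indexed by words, so that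
  \<open>Poly_Mapping.single w A\<close> is the monomial \<open>A w\<close>.\<close>

definition words :: "nat \<Rightarrow> nat \<Rightarrow> nat list set" where
  "words k m = {w. set w \<subseteq> {1..k} \<and> length w \<le> m}"

definition word_eval :: "(nat \<Rightarrow> quat) \<Rightarrow> nat list \<Rightarrow> quat" where
  "word_eval \<mu> w = prod_list (map \<mu> w)"

definition mv_stable ::
    "nat \<Rightarrow> nat \<Rightarrow> (nat list \<Rightarrow>\<^sub>0 quat ^ 'n ^ 'n) \<Rightarrow> quat set \<Rightarrow> bool" where
  "mv_stable k m P \<Omega> \<longleftrightarrow>
    (\<forall>y. y \<noteq> 0 \<longrightarrow> (\<forall>\<mu> \<in> {1..k} \<rightarrow> \<Omega>. \<exists>z. z \<noteq> 0 \<and>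
      (\<Sum>w\<in>words k m. sesq z (Poly_Mapping.lookup P w) y * word_eval \<mu> w) \<noteq> 0))"

lemma finite_words [simp]: "finite (words k m)"
  unfolding words_def by (rule finite_lists_length_le) simp

end

theory Submission
  imports Defs
begin

text \<open>
  Fix \<open>y \<noteq> 0\<close> and put \<open>a\<^sub>i = A\<^sub>i y\<close>, vectors of the right vector space \<open>\<H>\<^sup>n\<close>. A row vector \<open>c\<close>
  (playing the part of \<open>z\<^sup>*\<close>) acts on \<open>\<H>\<^sup>n\<close> as a right-linear functional, and if hyperstability
  fails at \<open>y\<close>, then every \<open>c \<noteq> 0\<close> has a root in \<open>\<Omega>\<close>: some \<open>\<mu> \<in> \<Omega>\<close> with
  \<open>c a\<^sub>2 \<mu>\<^sup>2 + c a\<^sub>1 \<mu> + c a\<^sub>0 = 0\<close>. Stability fails as soon as the vector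
  \<open>a\<^sub>2 \<mu>\<^sub>1\<^sup>2 + a\<^sub>1 \<mu>\<^sub>2 + a\<^sub>0\<close>, respectively \<open>a\<^sub>2 \<mu>\<^sub>1 \<mu>\<^sub>2 + a\<^sub>1 \<mu>\<^sub>2 + a\<^sub>0\<close>, vanishes for some
  \<open>\<mu>\<^sub>1, \<mu>\<^sub>2 \<in> \<Omega>\<close>; so the task is to produce such a pair from suitably chosen functionals.

  If \<open>a\<^sub>0\<close> is not in the span of \<open>a\<^sub>1, a\<^sub>2\<close>, a functional that vanishes on \<open>a\<^sub>1, a\<^sub>2\<close> but not on
  \<open>a\<^sub>0\<close> has no root at all. If \<open>a\<^sub>1, a\<^sub>2\<close> are dependent and \<open>a\<^sub>0\<close> is in their span, all three are
  multiples of one vector \<open>v\<close>. If \<open>v \<noteq> 0\<close>, the root \<open>\<mu>\<close> of a functional with value \<open>1\<close> on \<open>v\<close>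
  makes \<open>a\<^sub>2 \<mu>\<^sup>2 + a\<^sub>1 \<mu> + a\<^sub>0\<close> itself vanish; if \<open>v = 0\<close>, any \<open>\<mu> \<in> \<Omega>\<close> does. Then \<open>\<mu>\<^sub>1 = \<mu>\<^sub>2 = \<mu>\<close> works. There remains the
  case of independent \<open>a\<^sub>1, a\<^sub>2\<close> with \<open>a\<^sub>0 = a\<^sub>1 p + a\<^sub>2 q\<close>, where the values \<open>s, t\<close> of a functional
  on \<open>a\<^sub>1, a\<^sub>2\<close> can be prescribed (the lemma \<open>root_cases\<close> reduces to these last two cases). The values \<open>1, 0\<close> show
  that \<open>- p \<in> \<Omega>\<close>, which is taken as \<open>\<mu>\<^sub>2\<close>. For the first polynomial, the values \<open>0, 1\<close> give
  \<open>\<mu>\<^sub>1 \<in> \<Omega>\<close> with \<open>\<mu>\<^sub>1\<^sup>2 = - q\<close>. For the second one \<open>p \<noteq> 0\<close>, and the values \<open>- q p\<^sup>-\<^sup>1, 1\<close> kill the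
  constant term, so that \<open>(\<mu> - q p\<^sup>-\<^sup>1) \<mu> = 0\<close> for some \<open>\<mu> \<in> \<Omega>\<close>; as \<open>\<mu> \<noteq> 0\<close>, this gives
  \<open>\<mu>\<^sub>1 = q p\<^sup>-\<^sup>1 \<in> \<Omega>\<close>, and \<open>\<mu>\<^sub>1 \<mu>\<^sub>2 = - q\<close>.
\<close>

section \<open>Functionals on the right vector space of columns\<close>

text \<open>Right multiplication of a column vector by a scalar.\<close>

definition rscale :: "'a::ring_1 ^ 'n \<Rightarrow> 'a \<Rightarrow> 'a ^ 'n" where
  "rscale v r = (\<chi> i. v $ i * r)"

text \<open>The product of a row vector \<open>c\<close> and a column vector \<open>v\<close>; it is left-linear in \<open>c\<close> and
  right-linear in \<open>v\<close>.\<close>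

definition pairing :: "'a::ring_1 ^ 'n \<Rightarrow> 'a ^ 'n \<Rightarrow> 'a" where
  "pairing c v = (\<Sum>i\<in>UNIV. c $ i * v $ i)"

lemma pairing_simps [simp]:
  "pairing c (u + v) = pairing c u + pairing c v"
  "pairing c (u - v) = pairing c u - pairing c v"
  "pairing c (rscale v r) = pairing c v * r"
  "pairing (c + d) v = pairing c v + pairing d v"
  "pairing (c - d) v = pairing c v - pairing d v"
  "pairing (s *s c) v = s * pairing c v"
  "pairing c 0 = 0"
  "pairing 0 v = 0"
  by (simp_all add: pairing_def rscale_def vector_scalar_mult_def algebra_simps
      sum.distrib sum_subtractf sum_distrib_left sum_distrib_right)

lemma rscale_simps [simp]:
  "rscale (rscale v r) s = rscale v (r * s)"
  "rscale v 0 = 0" "rscale v 1 = v"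
  "rscale 0 r = 0"
  by (simp_all add: rscale_def vec_eq_iff mult.assoc)

lemma rscale_add_right: "rscale v (r + s) = rscale v r + rscale v s"
  and rscale_minus_right: "rscale v (- r) = - rscale v r"
  by (simp_all add: rscale_def vec_eq_iff algebra_simps)

lemma exists_pairing_eq_1:
  fixes a :: "'a::division_ring ^ 'n"
  assumes "a \<noteq> 0"
  obtains c where "pairing c a = 1"
proof -
  obtain j where j: "a $ j \<noteq> 0"
    using assms by (auto simp: vec_eq_iff)
  have "pairing (axis j (inverse (a $ j))) a = (\<Sum>i\<in>UNIV. if i = j then 1 else 0)"
    unfolding pairing_def by (rule sum.cong) (auto simp: axis_def j)
  then show thesis
    by (intro that[of "axis j (inverse (a $ j))"]) simp
qed

lemma exists_pairing_separating:
  fixes a b :: "'a::division_ring ^ 'n"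
  assumes "\<And>r. b \<noteq> rscale a r"
  obtains c where "pairing c a = 0" "pairing c b = 1"
proof (cases "a = 0")
  case True
  then have "b \<noteq> 0"
    using assms[of 0] by simp
  then show thesis
    using exists_pairing_eq_1 that True by (metis pairing_simps(7))
next
  case False
  then obtain c where c: "pairing c a = 1"
    using exists_pairing_eq_1 by blast
  have "b - rscale a (pairing c b) \<noteq> 0"
    using assms by simp
  then obtain d where d: "pairing d (b - rscale a (pairing c b)) = 1"
    using exists_pairing_eq_1 by blast
  show thesis
    using c d by (intro that[of "d - pairing d a *s c"]) (simp_all add: algebra_simps)
qed

text \<open>If \<open>b\<close> is not a multiple of \<open>a\<close>, take a functional \<open>c\<close> with values \<open>0, 1\<close> on \<open>a, b\<close>, and
  separate the projection \<open>v - b (c v)\<close> of \<open>v\<close> to the kernel of \<open>c\<close> from \<open>a\<close>.\<close>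

lemma exists_pairing_separating2:
  fixes a b v :: "'a::division_ring ^ 'n"
  assumes "\<And>r s. v \<noteq> rscale a r + rscale b s"
  obtains c where "pairing c a = 0" "pairing c b = 0" "pairing c v = 1"
proof (cases "\<exists>r. b = rscale a r")
  case True
  then obtain r where r: "b = rscale a r" ..
  obtain c where "pairing c a = 0" "pairing c v = 1"
    using exists_pairing_separating[of v a] assms[of _ 0] by auto
  then show thesis
    using that[of c] r by simp
next
  case False
  then obtain c where c: "pairing c a = 0" "pairing c b = 1"
    using exists_pairing_separating[of b a] by auto
  have "v - rscale b (pairing c v) \<noteq> rscale a r" for r
    using assms[of r "pairing c v"] by (auto simp: algebra_simps)
  then obtain d where d: "pairing d a = 0" "pairing d (v - rscale b (pairing c v)) = 1"
    using exists_pairing_separating[of "v - rscale b (pairing c v)" a] by auto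
  show thesis
    using c d by (intro that[of "d - pairing d b *s c"]) (simp_all add: algebra_simps)
qed

lemma exists_pairing_prescribed:
  fixes a b :: "'a::division_ring ^ 'n"
  assumes "\<And>r. b \<noteq> rscale a r" "\<And>r. a \<noteq> rscale b r"
  obtains c where "pairing c a = s" "pairing c b = t"
proof -
  obtain c d where "pairing c b = 0" "pairing c a = 1" "pairing d a = 0" "pairing d b = 1"
    using exists_pairing_separating[of a b] exists_pairing_separating[of b a] assms by metis
  then show thesis
    by (intro that[of "s *s c + t *s d"]) simp_all
qed

section \<open>Functionals with a quadratic root\<close>

text \<open>If three vectors are multiples of one vector, then a single functional detects whether their
  quadratic combination vanishes.\<close>

lemma root_of_collinear:
  fixes v :: "'a::division_ring ^ 'n"
  assumes roots: "\<forall>c. c \<noteq> 0 \<longrightarrow>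
      (\<exists>\<mu>\<in>\<Omega>. pairing c a2 * \<mu>\<^sup>2 + pairing c a1 * \<mu> + pairing c a0 = 0)"
    and "\<Omega> \<noteq> {}"
    and a: "a0 = rscale v r0" "a1 = rscale v r1" "a2 = rscale v r2"
  shows "\<exists>\<mu>\<in>\<Omega>. rscale a2 (\<mu>\<^sup>2) + rscale a1 \<mu> + a0 = 0"
proof (cases "v = 0")
  case True
  then show ?thesis
    using a \<open>\<Omega> \<noteq> {}\<close> by auto
next
  case False
  then obtain c where c: "pairing c v = 1"
    using exists_pairing_eq_1 by blast
  then have "c \<noteq> 0"
    by auto
  then obtain \<mu> where \<mu>: "\<mu> \<in> \<Omega>" "r2 * \<mu>\<^sup>2 + r1 * \<mu> + r0 = 0"
    using roots[rule_format, of c] c by (auto simp: a)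
  have "rscale a2 (\<mu>\<^sup>2) + rscale a1 \<mu> + a0 = rscale v (r2 * \<mu>\<^sup>2 + r1 * \<mu> + r0)"
    by (simp add: a rscale_add_right)
  then show ?thesis
    using \<mu> by auto
qed

text \<open>In the second case the values \<open>s, t\<close> of a functional on \<open>a\<^sub>1, a\<^sub>2\<close> are arbitrary, and
  \<open>s p + t q\<close> is then its value on \<open>a\<^sub>0\<close>. The side condition keeps the functional nonzero.\<close>

lemma root_cases:
  fixes a0 a1 a2 :: "'a::division_ring ^ 'n"
  assumes roots: "\<forall>c. c \<noteq> 0 \<longrightarrow>
      (\<exists>\<mu>\<in>\<Omega>. pairing c a2 * \<mu>\<^sup>2 + pairing c a1 * \<mu> + pairing c a0 = 0)"
    and "\<Omega> \<noteq> {}"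
  obtains (diagonal) \<mu> where "\<mu> \<in> \<Omega>" "rscale a2 (\<mu>\<^sup>2) + rscale a1 \<mu> + a0 = 0"
  | (independent) p q where "a0 = rscale a1 p + rscale a2 q"
      "\<And>s t. s \<noteq> 0 \<or> t \<noteq> 0 \<Longrightarrow> \<exists>\<mu>\<in>\<Omega>. t * \<mu>\<^sup>2 + s * \<mu> + (s * p + t * q) = 0"
proof -
  have "\<exists>p q. a0 = rscale a1 p + rscale a2 q"
  proof (rule ccontr)
    assume "\<not> ?thesis"
    then obtain c where c: "pairing c a1 = 0" "pairing c a2 = 0" "pairing c a0 = 1"
      using exists_pairing_separating2[of a0 a1 a2] by auto
    then have "c \<noteq> 0"
      by auto
    then show False
      using roots[rule_format, of c] c by auto
  qed
  then obtain p q where pq: "a0 = rscale a1 p + rscale a2 q"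
    by blast
  consider r where "a2 = rscale a1 r" | r where "a1 = rscale a2 r"
    | "\<And>r. a2 \<noteq> rscale a1 r" "\<And>r. a1 \<noteq> rscale a2 r"
    by blast
  then show thesis
  proof cases
    case (1 r)
    then have "a0 = rscale a1 (p + r * q)" "a1 = rscale a1 1"
      by (simp_all add: pq rscale_add_right)
    then show ?thesis
      using root_of_collinear[OF roots \<open>\<Omega> \<noteq> {}\<close> _ _ 1] diagonal by blast
  next
    case (2 r)
    then have "a0 = rscale a2 (r * p + q)" "a2 = rscale a2 1"
      by (simp_all add: pq rscale_add_right)
    then show ?thesis
      using root_of_collinear[OF roots \<open>\<Omega> \<noteq> {}\<close> _ 2] diagonal by blast
  next
    case 3
    show ?thesis
    proof (rule independent[OF pq])
      fix s t :: 'a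
      assume st: "s \<noteq> 0 \<or> t \<noteq> 0"
      obtain c where c: "pairing c a1 = s" "pairing c a2 = t"
        using exists_pairing_prescribed[of a2 a1 s t] 3 by blast
      then have "c \<noteq> 0"
        using st by auto
      then show "\<exists>\<mu>\<in>\<Omega>. t * \<mu>\<^sup>2 + s * \<mu> + (s * p + t * q) = 0"
        using roots[rule_format, of c] c pq by simp
    qed
  qed
qed

lemma minus_mem_of_roots:
  fixes p q :: "'a::division_ring"
  assumes "\<And>s t. s \<noteq> 0 \<or> t \<noteq> 0 \<Longrightarrow> \<exists>\<mu>\<in>\<Omega>. t * \<mu>\<^sup>2 + s * \<mu> + (s * p + t * q) = 0"
  shows "- p \<in> \<Omega>"
  using assms[of 1 0] by (auto simp: add_eq_0_iff2)

lemma exists_zero_squares: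
  fixes a0 a1 a2 :: "'a::division_ring ^ 'n"
  assumes roots: "\<forall>c. c \<noteq> 0 \<longrightarrow>
      (\<exists>\<mu>\<in>\<Omega>. pairing c a2 * \<mu>\<^sup>2 + pairing c a1 * \<mu> + pairing c a0 = 0)"
    and "\<Omega> \<noteq> {}"
  obtains \<mu>1 \<mu>2 where "\<mu>1 \<in> \<Omega>" "\<mu>2 \<in> \<Omega>" "rscale a2 (\<mu>1 * \<mu>1) + rscale a1 \<mu>2 + a0 = 0"
  using roots \<open>\<Omega> \<noteq> {}\<close>
proof (cases rule: root_cases)
  case (diagonal \<mu>)
  then show ?thesis
    using that by (simp add: power2_eq_square)
next
  case (independent p q)
  obtain \<mu> where "\<mu> \<in> \<Omega>" "\<mu> * \<mu> = - q"
    using independent(2)[of 0 1] by (auto simp: power2_eq_square add_eq_0_iff2)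
  then show ?thesis
    using that[of \<mu> "- p"] minus_mem_of_roots[OF independent(2)] independent(1)
    by (simp add: rscale_minus_right)
qed

lemma exists_zero_products:
  fixes a0 a1 a2 :: "'a::division_ring ^ 'n"
  assumes roots: "\<forall>c. c \<noteq> 0 \<longrightarrow>
      (\<exists>\<mu>\<in>\<Omega>. pairing c a2 * \<mu>\<^sup>2 + pairing c a1 * \<mu> + pairing c a0 = 0)"
    and "\<Omega> \<noteq> {}" and "0 \<notin> \<Omega>"
  obtains \<mu>1 \<mu>2 where "\<mu>1 \<in> \<Omega>" "\<mu>2 \<in> \<Omega>" "rscale a2 (\<mu>1 * \<mu>2) + rscale a1 \<mu>2 + a0 = 0"
  using roots \<open>\<Omega> \<noteq> {}\<close>
proof (cases rule: root_cases)
  case (diagonal \<mu>)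
  then show ?thesis
    using that by (simp add: power2_eq_square)
next
  case (independent p q)
  have p: "- p \<in> \<Omega>"
    using independent(2) by (rule minus_mem_of_roots)
  then have "p \<noteq> 0"
    using \<open>0 \<notin> \<Omega>\<close> by auto
  define m where "m = q * inverse p"
  have mp: "m * p = q"
    using \<open>p \<noteq> 0\<close> by (simp add: m_def mult.assoc)
  \<comment> \<open>The values \<open>- m\<close> on \<open>a\<^sub>1\<close> and \<open>1\<close> on \<open>a\<^sub>2\<close> give the value \<open>- m p + q = 0\<close> on \<open>a\<^sub>0\<close>.\<close>
  obtain \<mu> where \<mu>: "\<mu> \<in> \<Omega>" "\<mu>\<^sup>2 - m * \<mu> = 0"
    using independent(2)[of "- m" 1] mp by auto
  then have "(\<mu> - m) * \<mu> = 0"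
    by (simp add: power2_eq_square algebra_simps)
  then have "m \<in> \<Omega>"
    using \<mu>(1) \<open>0 \<notin> \<Omega>\<close> by auto
  then show ?thesis
    using that[of m "- p"] p mp independent(1) by (simp add: rscale_minus_right)
qed

section \<open>Hyperstability and stability in terms of functionals\<close>

lemma sesq_eq_pairing: "sesq z A y = pairing (\<chi> i. qcnj (z $ i)) (A *v y)"
  by (simp add: sesq_def pairing_def)

lemma qcnj_qcnj [simp]: "qcnj (qcnj x) = x"
  by (simp add: qcnj_def)

lemma not_hyperstable_imp_roots:
  assumes "\<not> hyperstable 2 [:A0, A1, A2:] \<Omega>"
  obtains y where "y \<noteq> 0" "\<forall>c. c \<noteq> 0 \<longrightarrow>
    (\<exists>\<mu>\<in>\<Omega>. pairing c (A2 *v y) * \<mu>\<^sup>2 + pairing c (A1 *v y) * \<mu> + pairing c (A0 *v y) = 0)"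
proof -
  obtain y where y: "y \<noteq> 0"
    and *: "\<And>z. z \<noteq> 0 \<Longrightarrow> \<exists>\<mu>\<in>\<Omega>. (\<Sum>i\<le>2. sesq z (coeff [:A0, A1, A2:] i) y * \<mu> ^ i) = 0"
    using assms unfolding hyperstable_def by blast
  show thesis
  proof (rule that[OF y], intro allI impI)
    fix c :: "quat ^ 'a"
    assume "c \<noteq> 0"
    define z where "z = (\<chi> i. qcnj (c $ i))"
    have c: "c = (\<chi> i. qcnj (z $ i))"
      by (simp add: z_def vec_eq_iff)
    have "qcnj 0 = 0"
      by (simp add: qcnj_def zero_quat_def)
    then have "z \<noteq> 0"
      using \<open>c \<noteq> 0\<close> c by (metis vec_eq_iff vec_lambda_beta zero_index)
    from *[OF this] show "\<exists>\<mu>\<in>\<Omega>. pairing c (A2 *v y) * \<mu>\<^sup>2 + pairing c (A1 *v y) * \<mu>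
        + pairing c (A0 *v y) = 0"
      by (simp add: sesq_eq_pairing flip: c)
         (simp add: numeral_2_eq_2 algebra_simps)
  qed
qed

text \<open>No distinctness of words is required: coefficients of equal words add up.\<close>

lemma sum_words_add_single:
  assumes "u \<in> words k m"
  shows "(\<Sum>w\<in>words k m. sesq z (Poly_Mapping.lookup (P + Poly_Mapping.single u A) w) y
            * word_eval \<mu> w)
       = (\<Sum>w\<in>words k m. sesq z (Poly_Mapping.lookup P w) y * word_eval \<mu> w)
         + sesq z A y * word_eval \<mu> u"
proof -
  have "sesq z (Poly_Mapping.lookup (P + Poly_Mapping.single u A) w) y * word_eval \<mu> w
      = sesq z (Poly_Mapping.lookup P w) y * word_eval \<mu> w
        + (if w = u then sesq z A y * word_eval \<mu> u else 0)" for w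
    by (auto simp: lookup_add lookup_single when_def sesq_eq_pairing
        matrix_vector_mult_add_rdistrib algebra_simps)
  then show ?thesis
    using assms by (simp add: sum.distrib)
qed

lemma mv_stable_imp_nonzero:
  assumes "mv_stable k m
      (Poly_Mapping.single u A2 + Poly_Mapping.single v A1 + Poly_Mapping.single w A0) \<Omega>"
    and "u \<in> words k m" "v \<in> words k m" "w \<in> words k m"
    and "y \<noteq> 0" "\<mu> \<in> {1..k} \<rightarrow> \<Omega>"
  shows "rscale (A2 *v y) (word_eval \<mu> u) + rscale (A1 *v y) (word_eval \<mu> v)
    + rscale (A0 *v y) (word_eval \<mu> w) \<noteq> 0" (is "?x \<noteq> 0")
proof
  assume x: "?x = 0"
  let ?P = "Poly_Mapping.single u A2 + Poly_Mapping.single v A1 + Poly_Mapping.single w A0"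
  obtain z where z: "(\<Sum>w\<in>words k m. sesq z (Poly_Mapping.lookup ?P w) y * word_eval \<mu> w) \<noteq> 0"
    using assms(1,5,6) unfolding mv_stable_def by blast
  have "(\<Sum>w\<in>words k m. sesq z (Poly_Mapping.lookup ?P w) y * word_eval \<mu> w)
      = sesq z A2 y * word_eval \<mu> u + sesq z A1 y * word_eval \<mu> v + sesq z A0 y * word_eval \<mu> w"
    using sum_words_add_single[OF assms(2), where P = 0 and A = A2 and z = z and y = y and \<mu> = \<mu>]
    by (simp add: sum_words_add_single assms(2-4)) (simp add: sesq_eq_pairing)
  also have "\<dots> = pairing (\<chi> i. qcnj (z $ i)) ?x"
    by (simp add: sesq_eq_pairing)
  finally show False
    using x z by simp
qed

section \<open>Stability implies hyperstability\<close>

theorem theorem4p35: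
  fixes A0 A1 A2 :: "quat ^ 'n ^ 'n" and \<Omega> :: "quat set"
  assumes "\<Omega> \<noteq> {}"
    and "mv_stable 2 2
           (Poly_Mapping.single [1, 1] A2 + Poly_Mapping.single [2] A1 + Poly_Mapping.single [] A0) \<Omega>
         \<or> mv_stable 2 2
           (Poly_Mapping.single [1, 2] A2 + Poly_Mapping.single [2] A1 + Poly_Mapping.single [] A0) \<Omega>
           \<and> 0 \<notin> \<Omega>"
  shows "hyperstable 2 [:A0, A1, A2:] \<Omega>"
proof (rule ccontr)
  assume "\<not> ?thesis"
  then obtain y where y: "y \<noteq> 0" and roots: "\<forall>c. c \<noteq> 0 \<longrightarrow>
    (\<exists>\<mu>\<in>\<Omega>. pairing c (A2 *v y) * \<mu>\<^sup>2 + pairing c (A1 *v y) * \<mu> + pairing c (A0 *v y) = 0)"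
    using not_hyperstable_imp_roots by blast
  have words: "[1, 1] \<in> words 2 2" "[1, 2] \<in> words 2 2" "[2] \<in> words 2 2" "[] \<in> words 2 2"
    by (simp_all add: words_def)
  define \<nu> where "\<nu> \<mu>1 \<mu>2 i = (if i = 1 then \<mu>1 else \<mu>2)" for \<mu>1 \<mu>2 :: quat and i :: nat
  have \<nu>: "\<nu> \<mu>1 \<mu>2 \<in> {1..2} \<rightarrow> \<Omega>" if "\<mu>1 \<in> \<Omega>" "\<mu>2 \<in> \<Omega>" for \<mu>1 \<mu>2
    using that by (auto simp: \<nu>_def)
  from assms(2) show False
  proof (elim disjE conjE)
    assume stable: "mv_stable 2 2
      (Poly_Mapping.single [1, 1] A2 + Poly_Mapping.single [2] A1 + Poly_Mapping.single [] A0) \<Omega>"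
    obtain \<mu>1 \<mu>2 where \<mu>: "\<mu>1 \<in> \<Omega>" "\<mu>2 \<in> \<Omega>"
      "rscale (A2 *v y) (\<mu>1 * \<mu>1) + rscale (A1 *v y) \<mu>2 + A0 *v y = 0"
      using exists_zero_squares[OF roots assms(1)] by blast
    show False
      using mv_stable_imp_nonzero[OF stable words(1,3,4) y \<nu>[OF \<mu>(1,2)]] \<mu>(3)
      by (simp add: word_eval_def \<nu>_def)
  next
    assume stable: "mv_stable 2 2
      (Poly_Mapping.single [1, 2] A2 + Poly_Mapping.single [2] A1 + Poly_Mapping.single [] A0) \<Omega>"
      and "0 \<notin> \<Omega>"
    then obtain \<mu>1 \<mu>2 where \<mu>: "\<mu>1 \<in> \<Omega>" "\<mu>2 \<in> \<Omega>"
      "rscale (A2 *v y) (\<mu>1 * \<mu>2) + rscale (A1 *v y) \<mu>2 + A0 *v y = 0"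
      using exists_zero_products[OF roots assms(1)] by blast
    show False
      using mv_stable_imp_nonzero[OF stable words(2-4) y \<nu>[OF \<mu>(1,2)]] \<mu>(3)
      by (simp add: word_eval_def \<nu>_def)
  qed
qed

end
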